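(* Let $n\ge2$ and let $K\subset\mathbb R^n$ be a quadratically convex orthosymmetric (QCO) set, i.e. 1. $K$ is convex, origin-symmetric, and sign-invariant; 2. the set $K^{(2)}:=\{x^2:x\in K\}$ is convex, where squaring is done coordinatewise. Then the norm $\rho_K(\cdot)$ induced by $K$ satisfies a type-2 inequality with constant $\sqrt{C\log n}$, i.e. $T_2(K)\lesssim\sqrt{\log n}$: there is an absolute constant $C$ such that $$\mathbb E\,\rho_K\Big(\sum_{i=1}^m\varepsilon_ix_i\Big)^2\le C(\log n)\sum_{i=1}^m\rho_K(x_i)^2$$ for all $m$ and all $x_1,\dots,x_m\in\mathbb R^n$, where $\varepsilon_i$ are i.i.d. Rademacher signs.
   Context: $\rho_K$ is the Minkowski gauge of $K$; $K$ is compact with $0$ in its interior, so that $\rho_K$ is a norm. Sign-invariant means $(\eta_1x_1,\dots,\eta_nx_n)\in K$ for all $x\in K$ and $\eta_i\in\{\pm1\}$. $T_2(K)$ is the smallest $T\ge1$ with $\mathbb E\rho_K^2(\sum_i\varepsilon_ix_i)\le T^2\sum_i\rho_K^2(x_i)$ for all finite collections. *)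

theory Defs
  imports "HOL-Probability.Probability" "HOL-Analysis.Finite_Function_Topology"
begin

text \<open>
  The constant in the theorem is uniform in the dimension \<open>n\<close>, so \<open>n\<close> must be quantified inside
  the statement and cannot be the cardinality of an index type. The space R^n is therefore the
  \<open>n\<close>-dimensional subspace of the finitely supported functions \<^typ>\<open>nat \<Rightarrow>\<^sub>0 real\<close> whose elements
  vanish outside the coordinates \<open>0, \<dots>, n - 1\<close>. The library makes \<^typ>\<open>nat \<Rightarrow>\<^sub>0 real\<close> a normed
  space (with the l1 norm), and this induces the usual topology on each of these subspaces.
\<close>

definition euclid :: "nat \<Rightarrow> (nat \<Rightarrow>\<^sub>0 real) set" where
  "euclid n = {x. Poly_Mapping.keys x \<subseteq> {..<n}}"

text \<open>Multiplication on \<^typ>\<open>nat \<Rightarrow>\<^sub>0 real\<close> is convolution, so squares and sign changes of vectors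
  are formed explicitly by coordinates.\<close>

definition coord_square :: "(nat \<Rightarrow>\<^sub>0 real) \<Rightarrow> (nat \<Rightarrow>\<^sub>0 real)" where
  "coord_square x = Poly_Mapping.map (\<lambda>t. t\<^sup>2) x"

definition sign_change :: "(nat \<Rightarrow> real) \<Rightarrow> (nat \<Rightarrow>\<^sub>0 real) \<Rightarrow> (nat \<Rightarrow>\<^sub>0 real)" where
  "sign_change \<eta> x = Poly_Mapping.mapp (\<lambda>i t. \<eta> i * t) x"

lemma lookup_coord_square [simp]:
  "Poly_Mapping.lookup (coord_square x) i = (Poly_Mapping.lookup x i)\<^sup>2"
  by (simp add: coord_square_def Poly_Mapping.map.rep_eq when_def)

lemma lookup_sign_change [simp]:
  "Poly_Mapping.lookup (sign_change \<eta> x) i = \<eta> i * Poly_Mapping.lookup x i"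
  by (auto simp: sign_change_def Poly_Mapping.lookup_mapp when_def in_keys_iff)

definition sign_invariant :: "nat \<Rightarrow> (nat \<Rightarrow>\<^sub>0 real) set \<Rightarrow> bool" where
  "sign_invariant n K \<longleftrightarrow>
     (\<forall>x\<in>K. \<forall>\<eta>. (\<forall>i<n. \<eta> i \<in> {-1, 1}) \<longrightarrow> sign_change \<eta> x \<in> K)"

definition qco :: "nat \<Rightarrow> (nat \<Rightarrow>\<^sub>0 real) set \<Rightarrow> bool" where
  "qco n K \<longleftrightarrow>
     K \<subseteq> euclid n \<and>
     convex K \<and> (\<forall>x\<in>K. - x \<in> K) \<and> sign_invariant n K \<and>
     convex (coord_square ` K)"

definition minkowski_gauge :: "'a::real_vector set \<Rightarrow> 'a \<Rightarrow> real" where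
  "minkowski_gauge K x = Inf {t. 0 < t \<and> x \<in> (*\<^sub>R) t ` K}"

text \<open>Joint law of \<open>m\<close> i.i.d. Rademacher signs \<open>\<epsilon> 0, \<dots>, \<epsilon> (m - 1)\<close>; the remaining entries
  of \<open>\<epsilon>\<close> take the irrelevant default value 0.\<close>

definition rademacher :: "nat \<Rightarrow> (nat \<Rightarrow> real) pmf" where
  "rademacher m = Pi_pmf {..<m} 0 (\<lambda>_. pmf_of_set {-1, 1})"

definition type2_const :: "nat \<Rightarrow> (nat \<Rightarrow>\<^sub>0 real) set \<Rightarrow> real" where
  "type2_const n K =
     (LEAST T. 1 \<le> T \<and>
        (\<forall>m x. (\<forall>i<m. x i \<in> euclid n) \<longrightarrow>
           measure_pmf.expectation (rademacher m)
             (\<lambda>\<epsilon>. (minkowski_gauge K (\<Sum>i<m. \<epsilon> i *\<^sub>R x i))\<^sup>2)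
           \<le> T\<^sup>2 * (\<Sum>i<m. (minkowski_gauge K (x i))\<^sup>2)))"

end

theory Submission
  imports Defs
begin

text \<open>
  Write \<open>v\<^sub>j\<close> for the sum over \<open>i\<close> of the squares of the \<open>j\<close>-th coordinates of the \<open>x\<^sub>i\<close>, and \<open>S\<^sub>j\<close>
  for the \<open>j\<close>-th coordinate of the Rademacher sum. Since \<open>K\<close> is solid and its coordinatewise squares
  form a convex set, \<open>S\<^sub>j\<^sup>2 \<le> W v\<^sub>j\<close> for all \<open>j\<close> implies that the squared gauge of the Rademacher sum
  is at most \<open>W\<close> times the sum of the squared gauges of the \<open>x\<^sub>i\<close>. It remains to find such a random
  \<open>W\<close> of expectation \<open>O(log n)\<close>. As \<open>E exp (S\<^sub>j\<^sup>2 / (4 v\<^sub>j)) \<le> 2\<close>, this is a maximal inequality for \<open>n\<close>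
  sub-Gaussian variables; replacing the maximum by the tangent line of the logarithm at \<open>2 n\<close> gives
  a bound \<open>W\<close> that is a sum of exponentials.
\<close>

section \<open>Square-exponential moments of Rademacher sums\<close>

lemma finite_set_pmf_rademacher: "finite (set_pmf (rademacher m))"
  unfolding rademacher_def by (subst set_Pi_pmf) auto

lemma integrable_rademacher [simp]:
  fixes f :: "(nat \<Rightarrow> real) \<Rightarrow> real"
  shows "integrable (measure_pmf (rademacher m)) f"
  by (rule integrable_measure_pmf_finite) (rule finite_set_pmf_rademacher)

lemma expectation_rademacher_Suc:
  fixes f :: "(nat \<Rightarrow> real) \<Rightarrow> real"
  shows "measure_pmf.expectation (rademacher (Suc m)) f =
    measure_pmf.expectation (rademacher m) (\<lambda>\<epsilon>. (f (\<epsilon>(m := -1)) + f (\<epsilon>(m := 1))) / 2)"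
proof -
  have "rademacher (Suc m) =
      pmf_of_set {-1, 1} \<bind> (\<lambda>y. map_pmf (\<lambda>\<epsilon>. \<epsilon>(m := y)) (rademacher m))"
    unfolding rademacher_def lessThan_Suc by (subst Pi_pmf_insert') (auto simp: map_pmf_def)
  then have "measure_pmf.expectation (rademacher (Suc m)) f =
      (\<Sum>y\<in>{-1, 1}. measure_pmf.expectation (map_pmf (\<lambda>\<epsilon>. \<epsilon>(m := y)) (rademacher m)) f
        /\<^sub>R real (card {-1, 1 :: real}))"
    by (simp only:, subst pmf_expectation_bind_pmf_of_set)
       (auto simp: finite_set_pmf_rademacher)
  then show ?thesis
    by (simp add: field_simps)
qed

lemma cosh_le_exp_half_square:
  fixes x :: real
  shows "cosh x \<le> exp (x\<^sup>2 / 2)"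
proof -
  \<comment> \<open>Hoeffding's cumulant bound for a fair two-point law on 0 and
    \<open>2 * |x|\<close>, whose centred version is a sign times \<open>|x|\<close>. The absolute
    value serves because that bound needs a nonnegative argument.\<close>
  have "- (2 * \<bar>x\<bar>) * (1 / 2) + ln (1 + 1 / 2 * (exp (2 * \<bar>x\<bar>) - 1)) \<le> (2 * \<bar>x\<bar>)\<^sup>2 / 8"
    by (rule Hoeffdings_lemma_aux) auto
  then have "ln ((1 + exp (2 * \<bar>x\<bar>)) / 2) \<le> x\<^sup>2 / 2 + \<bar>x\<bar>"
    by (simp add: field_simps)
  then have "exp (ln ((1 + exp (2 * \<bar>x\<bar>)) / 2)) \<le> exp (x\<^sup>2 / 2 + \<bar>x\<bar>)"
    by simp
  then have "(1 + exp (2 * \<bar>x\<bar>)) / 2 \<le> exp (x\<^sup>2 / 2 + \<bar>x\<bar>)"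
    by (subst (asm) exp_ln) (auto intro: add_pos_pos)
  moreover have "cosh x = exp (- \<bar>x\<bar>) * ((1 + exp (2 * \<bar>x\<bar>)) / 2)"
    by (cases "x \<ge> 0") (auto simp: cosh_def field_simps simp flip: exp_add)
  ultimately have "cosh x \<le> exp (- \<bar>x\<bar>) * exp (x\<^sup>2 / 2 + \<bar>x\<bar>)"
    by (simp only: mult_le_cancel_left_pos exp_gt_zero)
  then show ?thesis
    by (simp flip: exp_add)
qed

text \<open>Closes the induction step below: \<open>exp (b / 2)\<close> is the factor split off with
  the last sign. After squaring, it reduces to
  \<open>exp b * (1 - b) - w * exp b \<le> 1 - w * (1 + b)\<close>, which follows from
  \<open>1 - b \<le> exp (- b)\<close> and \<open>1 + b \<le> exp b\<close>.\<close>

lemma exp_div_sqrt_le: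
  fixes b w :: real
  assumes "0 \<le> b" "0 \<le> w" "w + b < 1"
  shows "exp (b / 2) / sqrt (1 - w * (1 + b)) \<le> 1 / sqrt (1 - (w + b))"
    and "w * (1 + b) < 1"
proof -
  have "w * b \<le> 1 * b"
    using assms by (intro mult_right_mono) auto
  then show less: "w * (1 + b) < 1"
    using assms by (simp add: distrib_left)
  have "exp b * (1 - b) \<le> 1"
    using mult_left_mono[of "1 - b" "exp (- b)" "exp b"] exp_ge_add_one_self[of "- b"]
    by (simp flip: exp_add)
  moreover have "w * (1 + b) \<le> w * exp b"
    using assms by (intro mult_left_mono) auto
  ultimately have "exp b * (1 - (w + b)) \<le> 1 - w * (1 + b)"
    by (simp add: algebra_simps)
  then have "sqrt (exp b * (1 - (w + b))) \<le> sqrt (1 - w * (1 + b))"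
    by (rule real_sqrt_le_mono)
  moreover have "sqrt (exp b) = exp (b / 2)"
    by (rule real_sqrt_unique) (simp_all flip: exp_double)
  ultimately have "exp (b / 2) * sqrt (1 - (w + b)) \<le> sqrt (1 - w * (1 + b))"
    by (simp add: real_sqrt_mult)
  then show "exp (b / 2) / sqrt (1 - w * (1 + b)) \<le> 1 / sqrt (1 - (w + b))"
    using less assms by (simp add: field_simps)
qed

text \<open>The bound is the exact value for a Gaussian variable of the same variance. In the induction,
  averaging over the last sign replaces \<open>c\<close> by \<open>c (1 + 2 c a\<^sub>m\<^sup>2)\<close>.\<close>

lemma expectation_exp_square_rademacher_sum:
  assumes "0 \<le> c" "2 * c * (\<Sum>i<m. (a i)\<^sup>2) < 1"
  shows "measure_pmf.expectation (rademacher m) (\<lambda>\<epsilon>. exp (c * (\<Sum>i<m. \<epsilon> i * a i)\<^sup>2))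
    \<le> 1 / sqrt (1 - 2 * c * (\<Sum>i<m. (a i)\<^sup>2))"
  using assms
proof (induction m arbitrary: c)
  case 0
  then show ?case by simp
next
  case (Suc m)
  define b where "b = 2 * c * (a m)\<^sup>2"
  define w where "w = 2 * c * (\<Sum>i<m. (a i)\<^sup>2)"
  define S where "S = (\<lambda>\<epsilon>. \<Sum>i<m. \<epsilon> i * a i)"
  have bw: "0 \<le> b" "0 \<le> w" "w + b < 1"
    using Suc.prems by (auto simp: b_def w_def sum_nonneg algebra_simps)
  have S_upd: "(\<Sum>i<Suc m. (\<epsilon>(m := s)) i * a i) = S \<epsilon> + s * a m" for \<epsilon> s
    by (simp add: S_def)
  have "(exp (c * (S \<epsilon> - a m)\<^sup>2) + exp (c * (S \<epsilon> + a m)\<^sup>2)) / 2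
      \<le> exp (b / 2) * exp (c * (1 + b) * (S \<epsilon>)\<^sup>2)" for \<epsilon>
  proof -
    have "(exp (c * (S \<epsilon> - a m)\<^sup>2) + exp (c * (S \<epsilon> + a m)\<^sup>2)) / 2 =
        exp (c * (S \<epsilon>)\<^sup>2 + c * (a m)\<^sup>2) * cosh (2 * c * S \<epsilon> * a m)"
      by (simp add: cosh_def power2_eq_square algebra_simps flip: exp_add)
    \<comment> \<open>Half the square of the cross term is
      \<open>c * b * (S \<epsilon>)\<^sup>2\<close>, a multiple of the exponent already
      present.\<close>
    also have "\<dots> \<le> exp (c * (S \<epsilon>)\<^sup>2 + c * (a m)\<^sup>2) * exp ((2 * c * S \<epsilon> * a m)\<^sup>2 / 2)"
      by (intro mult_left_mono cosh_le_exp_half_square) auto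
    also have "\<dots> = exp (b / 2) * exp (c * (1 + b) * (S \<epsilon>)\<^sup>2)"
      by (simp add: b_def power2_eq_square algebra_simps flip: exp_add)
    finally show ?thesis .
  qed
  then have "measure_pmf.expectation (rademacher (Suc m))
        (\<lambda>\<epsilon>. exp (c * (\<Sum>i<Suc m. \<epsilon> i * a i)\<^sup>2))
      \<le> measure_pmf.expectation (rademacher m)
          (\<lambda>\<epsilon>. exp (b / 2) * exp (c * (1 + b) * (S \<epsilon>)\<^sup>2))"
    unfolding expectation_rademacher_Suc S_upd by (intro integral_mono) auto
  also have "\<dots> = exp (b / 2) *
      measure_pmf.expectation (rademacher m) (\<lambda>\<epsilon>. exp (c * (1 + b) * (S \<epsilon>)\<^sup>2))"
    by simp
  \<comment> \<open>The induction hypothesis at \<open>c * (1 + b)\<close> is admissible because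
    \<open>w * (1 + b) < 1\<close>.\<close>
  also have "\<dots> \<le> exp (b / 2) * (1 / sqrt (1 - 2 * (c * (1 + b)) * (\<Sum>i<m. (a i)\<^sup>2)))"
    unfolding S_def using bw exp_div_sqrt_le(2)[OF bw] Suc.prems(1)
    by (intro mult_left_mono Suc.IH) (auto simp: w_def algebra_simps)
  also have "2 * (c * (1 + b)) * (\<Sum>i<m. (a i)\<^sup>2) = w * (1 + b)"
    by (simp add: w_def)
  also have "exp (b / 2) * (1 / sqrt (1 - w * (1 + b))) \<le> 1 / sqrt (1 - (w + b))"
    using exp_div_sqrt_le(1)[OF bw] by simp
  also have "w + b = 2 * c * (\<Sum>i<Suc m. (a i)\<^sup>2)"
    by (simp add: w_def b_def algebra_simps)
  finally show ?case .
qed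

text \<open>Division by zero makes this hold also when all \<open>a i\<close> vanish.\<close>

lemma expectation_exp_normalized_rademacher_sum:
  "measure_pmf.expectation (rademacher m)
    (\<lambda>\<epsilon>. exp ((\<Sum>i<m. \<epsilon> i * a i)\<^sup>2 / (4 * (\<Sum>i<m. (a i)\<^sup>2)))) \<le> 2"
proof -
  define c where "c = 1 / (4 * (\<Sum>i<m. (a i)\<^sup>2))"
  have cV: "2 * c * (\<Sum>i<m. (a i)\<^sup>2) \<le> 1 / 2"
    by (auto simp: c_def)
  have "measure_pmf.expectation (rademacher m) (\<lambda>\<epsilon>. exp (c * (\<Sum>i<m. \<epsilon> i * a i)\<^sup>2))
      \<le> 1 / sqrt (1 - 2 * c * (\<Sum>i<m. (a i)\<^sup>2))"
    using cV by (intro expectation_exp_square_rademacher_sum) (auto simp: c_def sum_nonneg)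
  \<comment> \<open>The radicand is at least 1/2; weakening this to 1/4 makes the constant
    rational.\<close>
  also have "\<dots> \<le> 1 / sqrt (1 / 4)"
    using cV by (intro divide_left_mono real_sqrt_le_mono mult_pos_pos) auto
  also have "\<dots> = 2"
    by (simp add: real_sqrt_divide)
  finally show ?thesis
    by (simp add: c_def)
qed

lemma rademacher_sums_maximal_inequality:
  fixes a :: "nat \<Rightarrow> nat \<Rightarrow> real"
  assumes "n > 0"
  obtains W where "\<And>\<epsilon>. 0 \<le> W \<epsilon>"
    and "\<And>\<epsilon> j. j < n \<Longrightarrow> (\<Sum>i<m. \<epsilon> i * a i j)\<^sup>2 \<le> W \<epsilon> * (\<Sum>i<m. (a i j)\<^sup>2)"
    and "measure_pmf.expectation (rademacher m) W \<le> 4 * ln (2 * real n)"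
proof
  define E where "E = (\<lambda>\<epsilon> j. exp ((\<Sum>i<m. \<epsilon> i * a i j)\<^sup>2 / (4 * (\<Sum>i<m. (a i j)\<^sup>2))))"
  \<comment> \<open>From \<open>ln t \<le> t - 1\<close> at
    \<open>t = E \<epsilon> j / (2 * real n)\<close>, with the sum of all
    \<open>E \<epsilon> j\<close> dominating each one; the factor 4 undoes the normalization in
    \<open>E\<close>. That sum has expectation at most \<open>2 * real n\<close>, so the fraction is
    at most 1 on average and cancels the \<open>- 1\<close>.\<close>
  define W where "W = (\<lambda>\<epsilon>. 4 * (ln (2 * real n) - 1 + (\<Sum>j<n. E \<epsilon> j) / (2 * real n)))"
  have W_ge: "(\<Sum>i<m. \<epsilon> i * a i j)\<^sup>2 / (\<Sum>i<m. (a i j)\<^sup>2) \<le> W \<epsilon>" if "j < n" for \<epsilon> j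
  proof -
    have "E \<epsilon> j \<le> (\<Sum>j<n. E \<epsilon> j)"
      by (intro member_le_sum) (use that in \<open>auto simp: E_def\<close>)
    then have "E \<epsilon> j / (2 * real n) \<le> (\<Sum>j<n. E \<epsilon> j) / (2 * real n)"
      by (simp add: divide_right_mono)
    moreover have "ln (E \<epsilon> j / (2 * real n)) \<le> E \<epsilon> j / (2 * real n) - 1"
      using assms by (intro ln_le_minus_one) (auto simp: E_def)
    moreover have "ln (E \<epsilon> j / (2 * real n)) = ln (E \<epsilon> j) - ln (2 * real n)"
      using assms by (simp add: E_def ln_div)
    ultimately show ?thesis
      by (simp add: W_def E_def)
  qed
  show "0 \<le> W \<epsilon>" for \<epsilon>
    using W_ge[OF assms] by (rule order_trans[rotated]) (simp add: sum_nonneg)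
  show "(\<Sum>i<m. \<epsilon> i * a i j)\<^sup>2 \<le> W \<epsilon> * (\<Sum>i<m. (a i j)\<^sup>2)" if "j < n" for \<epsilon> j
  \<comment> \<open>For zero variance the quotient in \<open>W_ge\<close> is 0 by convention and
    says nothing about the numerator.\<close>
  proof (cases "(\<Sum>i<m. (a i j)\<^sup>2) = 0")
    case True
    then have "\<forall>i<m. a i j = 0"
      by (simp add: sum_nonneg_eq_0_iff)
    then show ?thesis by simp
  next
    case False
    then have "(\<Sum>i<m. (a i j)\<^sup>2) > 0"
      by (simp add: sum_nonneg less_le)
    then show ?thesis
      using W_ge[OF that, of \<epsilon>] by (simp add: field_simps)
  qed
  have "(\<Sum>j<n. measure_pmf.expectation (rademacher m) (\<lambda>\<epsilon>. E \<epsilon> j)) \<le> (\<Sum>j<n. 2)"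
    unfolding E_def by (intro sum_mono expectation_exp_normalized_rademacher_sum)
  then show "measure_pmf.expectation (rademacher m) W \<le> 4 * ln (2 * real n)"
    using assms by (simp add: W_def field_simps)
qed

section \<open>Gauges of quadratically convex orthosymmetric sets\<close>

lemma lookup_scaleR_poly_mapping [simp]:
  "Poly_Mapping.lookup (r *\<^sub>R x) i = r *\<^sub>R Poly_Mapping.lookup x i"
proof -
  have "finite {i. r *\<^sub>R Poly_Mapping.lookup x i \<noteq> 0}"
    by (rule finite_subset[OF _ finite_keys[of x]]) (auto simp: in_keys_iff)
  then show ?thesis
    by (simp add: scaleR_poly_mapping_def)
qed

lemma euclid_iff: "x \<in> euclid n \<longleftrightarrow> (\<forall>i\<ge>n. Poly_Mapping.lookup x i = 0)"
  by (auto simp: euclid_def in_keys_iff subset_iff simp flip: not_less)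

lemma scaleR_in_euclid: "x \<in> euclid n \<Longrightarrow> r *\<^sub>R x \<in> euclid n"
  by (simp add: euclid_iff)

text \<open>A multiplier t in [-1, 1] is the average of 1 and -1 with weights (1 + t) / 2 and (1 -
  t) / 2, so convexity reduces it to sign changes, one coordinate at a time. \<open>J\<close> holds
  the coordinates not yet reduced to signs.\<close>

lemma qco_contract:
  assumes K: "qco n K" and z: "z \<in> K" and \<eta>: "\<And>i. i < n \<Longrightarrow> \<bar>\<eta> i\<bar> \<le> 1"
  shows "sign_change \<eta> z \<in> K"
proof -
  have conv: "convex K" and sgn: "sign_invariant n K"
    using K by (auto simp: qco_def)
  have "sign_change \<eta> z \<in> K"
    if "\<And>i. i \<in> J \<Longrightarrow> \<bar>\<eta> i\<bar> \<le> 1" "\<And>i. i < n \<Longrightarrow> i \<notin> J \<Longrightarrow> \<eta> i \<in> {-1, 1}" "finite J" for J \<eta>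
    using that(3,1,2)
  proof (induction J arbitrary: \<eta> rule: finite_induct)
    case empty
    then show ?case
      using sgn z by (auto simp: sign_invariant_def)
  next
    case (insert k J)
    have "sign_change (\<eta>(k := s)) z \<in> K" if "s \<in> {-1, 1}" for s
      using that insert.prems by (intro insert.IH) auto
    then have "((1 + \<eta> k) / 2) *\<^sub>R sign_change (\<eta>(k := 1)) z
        + ((1 - \<eta> k) / 2) *\<^sub>R sign_change (\<eta>(k := -1)) z \<in> K"
      using insert.prems(1)[of k] by (intro convexD[OF conv]) (auto simp: field_simps)
    also have "((1 + \<eta> k) / 2) *\<^sub>R sign_change (\<eta>(k := 1)) z
        + ((1 - \<eta> k) / 2) *\<^sub>R sign_change (\<eta>(k := -1)) z = sign_change \<eta> z"
      by (rule poly_mapping_eqI) (auto simp: lookup_add field_simps)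
    finally show ?case .
  qed
  from this[of "{..<n}" \<eta>] \<eta> show ?thesis by simp
qed

lemma qco_solid:
  assumes "qco n K" "z \<in> K" "y \<in> euclid n"
    and le: "\<And>j. j < n \<Longrightarrow> (Poly_Mapping.lookup y j)\<^sup>2 \<le> (Poly_Mapping.lookup z j)\<^sup>2"
  shows "y \<in> K"
proof -
  \<comment> \<open>Where \<open>z\<close> vanishes the quotient is 0, which is correct because
    \<open>y\<close> vanishes there too.\<close>
  define \<eta> where "\<eta> = (\<lambda>j. Poly_Mapping.lookup y j / Poly_Mapping.lookup z j)"
  have "sign_change \<eta> z \<in> K"
    using assms(1,2) le
    by (intro qco_contract[of n]) (auto simp: \<eta>_def abs_le_square_iff divide_le_eq_1)
  moreover have "sign_change \<eta> z = y"
  proof (rule poly_mapping_eqI)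
    fix j
    have "Poly_Mapping.lookup y j = 0" if "Poly_Mapping.lookup z j = 0"
      using le[of j] that assms(3) by (cases "j < n") (auto simp: euclid_iff)
    then show "Poly_Mapping.lookup (sign_change \<eta> z) j = Poly_Mapping.lookup y j"
      by (auto simp: \<eta>_def)
  qed
  ultimately show ?thesis by simp
qed

text \<open>Ensures that the infimum defining the gauge is over a nonempty set: small positive
  multiples of \<open>x\<close> enter a relative neighbourhood of 0 inside \<open>K\<close>.\<close>

lemma absorbing_euclid:
  assumes "0 \<in> (top_of_set (euclid n)) interior_of K" "x \<in> euclid n"
  shows "{t. 0 < t \<and> x \<in> (*\<^sub>R) t ` K} \<noteq> {}"
proof -
  obtain U where U: "open U" "0 \<in> U" "euclid n \<inter> U \<subseteq> K"
    using assms(1) by (force simp: interior_of_def openin_open)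
  have "((\<lambda>s. s *\<^sub>R x) \<longlongrightarrow> 0 *\<^sub>R x) (at_right 0)"
    by (intro tendsto_intros)
  then have "\<forall>\<^sub>F s in at_right 0. s *\<^sub>R x \<in> U"
    using U by (intro topological_tendstoD) auto
  moreover have "\<forall>\<^sub>F s in at_right 0. (0::real) < s"
    by (rule eventually_at_right_less)
  ultimately have "\<forall>\<^sub>F s in at_right (0::real). 0 < s \<and> s *\<^sub>R x \<in> U"
    by eventually_elim simp
  then obtain s where s: "0 < s" "s *\<^sub>R x \<in> U"
    using eventually_happens[of _ "at_right (0::real)"] by auto
  then have "s *\<^sub>R x \<in> K"
    using U assms(2) scaleR_in_euclid by blast
  then have "0 < inverse s \<and> x \<in> (*\<^sub>R) (inverse s) ` K"
    using s by (auto intro!: image_eqI[of _ _ "s *\<^sub>R x"])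
  then show ?thesis by blast
qed

lemma minkowski_gauge_le:
  assumes "0 < t" "k \<in> K"
  shows "minkowski_gauge K (t *\<^sub>R k) \<le> t"
  unfolding minkowski_gauge_def
  by (rule cInf_lower) (use assms in \<open>auto intro!: bdd_belowI[of _ 0]\<close>)

lemma minkowski_gauge_nonneg:
  assumes "{t. 0 < t \<and> x \<in> (*\<^sub>R) t ` K} \<noteq> {}"
  shows "0 \<le> minkowski_gauge K x"
  unfolding minkowski_gauge_def using assms by (intro cInf_greatest) auto

lemma minkowski_gauge_approx:
  assumes "{t. 0 < t \<and> x \<in> (*\<^sub>R) t ` K} \<noteq> {}" "0 < \<delta>"
  obtains t k where "0 < t" "t < minkowski_gauge K x + \<delta>" "k \<in> K" "x = t *\<^sub>R k"
proof -
  have "Inf {t. 0 < t \<and> x \<in> (*\<^sub>R) t ` K} < minkowski_gauge K x + \<delta>"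
    using assms(2) by (simp add: minkowski_gauge_def)
  from cInf_lessD[OF assms(1) this] that show ?thesis by blast
qed

text \<open>Quadratic convexity enters here: the weights \<open>(r i)\<^sup>2 / R\<close> form a
  convex combination of the squares of the \<open>k i\<close>, which is again the square of some
  \<open>z\<close> in \<open>K\<close>.\<close>

lemma qco_sum_squares_dominated:
  fixes m :: nat
  assumes K: "qco n K" and "0 \<in> K" and k: "\<And>i. i < m \<Longrightarrow> k i \<in> K"
    and r: "\<And>i. i < m \<Longrightarrow> 0 < r i"
  obtains z where "z \<in> K"
    "\<And>j. (\<Sum>i<m. (r i * Poly_Mapping.lookup (k i) j)\<^sup>2)
       = (\<Sum>i<m. (r i)\<^sup>2) * (Poly_Mapping.lookup z j)\<^sup>2"
proof (cases "m = 0")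
  case True
  with \<open>0 \<in> K\<close> show ?thesis by (intro that[of 0]) auto
next
  case False
  define R where "R = (\<Sum>i<m. (r i)\<^sup>2)"
  have R: "R > 0"
    unfolding R_def using False r by (intro sum_pos) (auto simp: less_imp_neq[symmetric])
  have "(\<Sum>i<m. ((r i)\<^sup>2 / R) *\<^sub>R coord_square (k i)) \<in> coord_square ` K"
  proof (rule convex_sum)
    show "(\<Sum>i<m. (r i)\<^sup>2 / R) = 1"
      using R by (simp add: R_def flip: sum_divide_distrib)
  qed (use K k R in \<open>auto simp: qco_def\<close>)
  then obtain z where z: "z \<in> K"
      "coord_square z = (\<Sum>i<m. ((r i)\<^sup>2 / R) *\<^sub>R coord_square (k i))"
    by auto
  have "(Poly_Mapping.lookup z j)\<^sup>2 = (\<Sum>i<m. (r i * Poly_Mapping.lookup (k i) j)\<^sup>2) / R" for j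
    using arg_cong[OF z(2), of "\<lambda>x. Poly_Mapping.lookup x j"]
    by (simp add: lookup_sum power_mult_distrib sum_divide_distrib)
  with R show ?thesis
    by (intro that[OF z(1)]) (simp flip: R_def)
qed

text \<open>Writing \<open>x i = r i *\<^sub>R k i\<close> with \<open>r i\<close> close to the
  gauge, the preceding lemma bounds the squares of \<open>y\<close> by
  \<open>W * (\<Sum>i<m. (r i)\<^sup>2)\<close> times those of one \<open>z\<close> in
  \<open>K\<close>; solidity then puts a rescaled \<open>y\<close> into \<open>K\<close>.\<close>

lemma qco_gauge_square_le:
  fixes m :: nat
  assumes K: "qco n K" and int: "0 \<in> (top_of_set (euclid n)) interior_of K"
    and x: "\<And>i. i < m \<Longrightarrow> x i \<in> euclid n" and y: "y \<in> euclid n" and "0 \<le> W"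
    and le: "\<And>j. j < n \<Longrightarrow>
      (Poly_Mapping.lookup y j)\<^sup>2 \<le> W * (\<Sum>i<m. (Poly_Mapping.lookup (x i) j)\<^sup>2)"
  shows "(minkowski_gauge K y)\<^sup>2 \<le> W * (\<Sum>i<m. (minkowski_gauge K (x i))\<^sup>2)"
proof -
  have "0 \<in> K"
    using int interior_of_subset[of "top_of_set (euclid n)" K] by auto
  \<comment> \<open>The inner \<open>\<delta>\<close> absorbs the error of the near-minimal
    \<open>r i\<close>; the outer one keeps \<open>B \<delta>\<close> positive, so that dividing by
    its root is possible even if \<open>W = 0\<close>. Both vanish in the limit at the end.\<close>
  define B where "B = (\<lambda>\<delta>. W * (\<Sum>i<m. (minkowski_gauge K (x i) + \<delta>)\<^sup>2) + \<delta>)"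
  have approx: "(minkowski_gauge K y)\<^sup>2 \<le> B \<delta>" if "0 < \<delta>" for \<delta>
  proof -
    have "\<exists>t k. 0 < t \<and> t < minkowski_gauge K (x i) + \<delta> \<and> k \<in> K \<and> x i = t *\<^sub>R k" if "i < m" for i
      using minkowski_gauge_approx[OF absorbing_euclid[OF int x[OF that]] \<open>0 < \<delta>\<close>] by metis
    then obtain r k where rk: "\<And>i. i < m \<Longrightarrow>
        0 < r i \<and> r i < minkowski_gauge K (x i) + \<delta> \<and> k i \<in> K \<and> x i = r i *\<^sub>R k i"
      by metis
    obtain z where z: "z \<in> K" "\<And>j. (\<Sum>i<m. (r i * Poly_Mapping.lookup (k i) j)\<^sup>2)
        = (\<Sum>i<m. (r i)\<^sup>2) * (Poly_Mapping.lookup z j)\<^sup>2"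
      using qco_sum_squares_dominated[OF K \<open>0 \<in> K\<close>, of m k r] rk by blast
    have B: "W * (\<Sum>i<m. (r i)\<^sup>2) \<le> B \<delta>" "0 < B \<delta>"
    proof -
      have "(\<Sum>i<m. (r i)\<^sup>2) \<le> (\<Sum>i<m. (minkowski_gauge K (x i) + \<delta>)\<^sup>2)"
        by (intro sum_mono power_mono) (use rk in \<open>force simp: less_imp_le\<close>)+
      then show "W * (\<Sum>i<m. (r i)\<^sup>2) \<le> B \<delta>"
        unfolding B_def using \<open>0 \<le> W\<close> \<open>0 < \<delta>\<close> by (intro add_increasing2 mult_left_mono) auto
      show "0 < B \<delta>"
        unfolding B_def using \<open>0 \<le> W\<close> \<open>0 < \<delta>\<close>
        by (intro add_nonneg_pos mult_nonneg_nonneg sum_nonneg) auto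
    qed
    define q where "q = sqrt (B \<delta>)"
    have q: "0 < q" "q\<^sup>2 = B \<delta>"
      using B(2) by (auto simp: q_def)
    have "inverse q *\<^sub>R y \<in> K"
    proof (rule qco_solid[OF K z(1) scaleR_in_euclid[OF y]])
      fix j assume "j < n"
      have "(\<Sum>i<m. (Poly_Mapping.lookup (x i) j)\<^sup>2)
          = (\<Sum>i<m. (r i * Poly_Mapping.lookup (k i) j)\<^sup>2)"
        using rk by (intro sum.cong) auto
      then have "(Poly_Mapping.lookup y j)\<^sup>2 \<le> (W * (\<Sum>i<m. (r i)\<^sup>2)) * (Poly_Mapping.lookup z j)\<^sup>2"
        using le[OF \<open>j < n\<close>] z(2)[of j] by (simp add: mult.assoc)
      also have "\<dots> \<le> q\<^sup>2 * (Poly_Mapping.lookup z j)\<^sup>2"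
        unfolding q(2) by (intro mult_right_mono B(1)) auto
      finally show "(Poly_Mapping.lookup (inverse q *\<^sub>R y) j)\<^sup>2 \<le> (Poly_Mapping.lookup z j)\<^sup>2"
        using q(1) by (simp add: power_mult_distrib power_inverse field_simps)
    qed
    from minkowski_gauge_le[OF q(1) this] have "minkowski_gauge K y \<le> q"
      using q(1) by simp
    then show ?thesis
      using minkowski_gauge_nonneg[OF absorbing_euclid[OF int y]] by (simp flip: q(2))
  qed
  have "(B \<longlongrightarrow> W * (\<Sum>i<m. (minkowski_gauge K (x i) + 0)\<^sup>2) + 0) (at_right 0)"
    unfolding B_def by (intro tendsto_intros)
  moreover have "\<forall>\<^sub>F \<delta> in at_right 0. (minkowski_gauge K y)\<^sup>2 \<le> B \<delta>"
    using eventually_at_right_less[of "0::real"] by eventually_elim (rule approx)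
  ultimately have "(minkowski_gauge K y)\<^sup>2 \<le> W * (\<Sum>i<m. (minkowski_gauge K (x i) + 0)\<^sup>2) + 0"
    by (intro tendsto_lowerbound) auto
  then show ?thesis by simp
qed

section \<open>The type-2 inequality\<close>

lemma qco_type2:
  assumes n: "n \<ge> 2" and K: "qco n K" and int: "0 \<in> (top_of_set (euclid n)) interior_of K"
    and x: "\<And>i. i < m \<Longrightarrow> x i \<in> euclid n"
  shows "measure_pmf.expectation (rademacher m)
      (\<lambda>\<epsilon>. (minkowski_gauge K (\<Sum>i<m. \<epsilon> i *\<^sub>R x i))\<^sup>2)
    \<le> 8 * ln (real n) * (\<Sum>i<m. (minkowski_gauge K (x i))\<^sup>2)"
proof -
  define G where "G = (\<Sum>i<m. (minkowski_gauge K (x i))\<^sup>2)"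
  have "0 \<le> G"
    by (simp add: G_def sum_nonneg)
  obtain W where W: "\<And>\<epsilon>. 0 \<le> W \<epsilon>"
    "\<And>\<epsilon> j. j < n \<Longrightarrow> (\<Sum>i<m. \<epsilon> i * Poly_Mapping.lookup (x i) j)\<^sup>2
        \<le> W \<epsilon> * (\<Sum>i<m. (Poly_Mapping.lookup (x i) j)\<^sup>2)"
    "measure_pmf.expectation (rademacher m) W \<le> 4 * ln (2 * real n)"
    using rademacher_sums_maximal_inequality[where n = n and m = m and a = "\<lambda>i. Poly_Mapping.lookup (x i)"] n by auto
  have "(minkowski_gauge K (\<Sum>i<m. \<epsilon> i *\<^sub>R x i))\<^sup>2 \<le> W \<epsilon> * G" for \<epsilon>
    unfolding G_def using x W(1,2)
    by (intro qco_gauge_square_le[OF K int]) (auto simp: lookup_sum euclid_iff)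
  then have "measure_pmf.expectation (rademacher m)
      (\<lambda>\<epsilon>. (minkowski_gauge K (\<Sum>i<m. \<epsilon> i *\<^sub>R x i))\<^sup>2)
      \<le> measure_pmf.expectation (rademacher m) (\<lambda>\<epsilon>. W \<epsilon> * G)"
    by (intro integral_mono) auto
  also have "\<dots> \<le> 4 * ln (2 * real n) * G"
    using W(3) \<open>0 \<le> G\<close> by (simp add: mult_right_mono)
  \<comment> \<open>Uses \<open>ln 2 \<le> ln (real n)\<close>.\<close>
  also have "\<dots> \<le> 8 * ln (real n) * G"
    using n \<open>0 \<le> G\<close> by (intro mult_right_mono) (auto simp: ln_mult)
  finally show ?thesis
    unfolding G_def .
qed

text \<open>\<^const>\<open>type2_const\<close> is a least element in the real numbers, which has a meaning only because
  the set of admissible constants is closed.\<close>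

lemma type2_const_le:
  assumes "1 \<le> T"
    and "\<And>m x. (\<And>i. i < m \<Longrightarrow> x i \<in> euclid n) \<Longrightarrow>
      measure_pmf.expectation (rademacher m)
        (\<lambda>\<epsilon>. (minkowski_gauge K (\<Sum>i<m. \<epsilon> i *\<^sub>R x i))\<^sup>2)
      \<le> T\<^sup>2 * (\<Sum>i<m. (minkowski_gauge K (x i))\<^sup>2)"
  shows "type2_const n K \<le> T"
proof -
  define P where "P = (\<lambda>T. 1 \<le> T \<and> (\<forall>m x. (\<forall>i<m. x i \<in> euclid n) \<longrightarrow>
    measure_pmf.expectation (rademacher m)
      (\<lambda>\<epsilon>. (minkowski_gauge K (\<Sum>i<m. \<epsilon> i *\<^sub>R x i))\<^sup>2)
    \<le> T\<^sup>2 * (\<Sum>i<m. (minkowski_gauge K (x i))\<^sup>2)))"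
  have "closed (Collect P)"
    unfolding P_def
    by (intro closed_Collect_conj closed_Collect_all closed_Collect_imp closed_Collect_le
        continuous_intros open_Collect_const)
  moreover have "P T"
    using assms by (auto simp: P_def)
  moreover have bdd: "bdd_below (Collect P)"
    by (rule bdd_belowI[of _ 1]) (auto simp: P_def)
  ultimately have "P (Inf (Collect P))"
    using closed_contains_Inf[of "Collect P"] by auto
  then have "Least P = Inf (Collect P)"
    using bdd by (intro Least_equality) (auto intro: cInf_lower)
  also have "\<dots> \<le> T"
    using bdd \<open>P T\<close> by (intro cInf_lower) auto
  finally show ?thesis
    by (simp add: type2_const_def P_def)
qed

theorem lemma6p1:
  shows "\<exists>C::real. C > 0 \<and>
    (\<forall>(n::nat) (K :: (nat \<Rightarrow>\<^sub>0 real) set).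
       n \<ge> 2 \<longrightarrow> qco n K \<longrightarrow> compact K \<longrightarrow>
       0 \<in> (top_of_set (euclid n)) interior_of K \<longrightarrow>
         (\<forall>(m::nat) (x :: nat \<Rightarrow> nat \<Rightarrow>\<^sub>0 real). (\<forall>i<m. x i \<in> euclid n) \<longrightarrow>
            measure_pmf.expectation (rademacher m)
              (\<lambda>\<epsilon>. (minkowski_gauge K (\<Sum>i<m. \<epsilon> i *\<^sub>R x i))\<^sup>2)
            \<le> C * ln (real n) * (\<Sum>i<m. (minkowski_gauge K (x i))\<^sup>2)) \<and>
         type2_const n K \<le> sqrt (C * ln (real n)))"
proof (intro exI[of _ 8] conjI allI impI)
  fix n :: nat and K :: "(nat \<Rightarrow>\<^sub>0 real) set"
  assume n: "n \<ge> 2" and K: "qco n K" and int: "0 \<in> (top_of_set (euclid n)) interior_of K"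
  show "measure_pmf.expectation (rademacher m)
      (\<lambda>\<epsilon>. (minkowski_gauge K (\<Sum>i<m. \<epsilon> i *\<^sub>R x i))\<^sup>2)
      \<le> 8 * ln (real n) * (\<Sum>i<m. (minkowski_gauge K (x i))\<^sup>2)"
    if "\<forall>i<m. x i \<in> euclid n" for m x
    using qco_type2[OF n K int] that by blast
  \<comment> \<open>Needed for the requirement \<open>1 \<le> T\<close> in
    \<open>type2_const\<close>.\<close>
  have "1 / 2 \<le> ln (2::real)"
    using ln_le_minus_one[of "1 / 2 :: real"] by (simp add: ln_div)
  moreover have "ln 2 \<le> ln (real n)"
    using n by simp
  ultimately have ln: "1 \<le> 8 * ln (real n)"
    by linarith
  show "type2_const n K \<le> sqrt (8 * ln (real n))"
    using ln qco_type2[OF n K int] by (intro type2_const_le) auto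
qed simp

end
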